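(* Let $N\ge 2$ and let $I_1,\dots,I_N$ be positive integers. The global average pooling (GAP) layer $\mathbb{R}^{I_1\times\cdots\times I_N}\to\mathbb{R}^{I_N}$, $\mathcal{X}\mapsto\mathbf{y}$, is equal to a specific Tucker tensor regression layer (with zero bias) of Tucker rank $(1,\dots,1,I_N,I_N)$. Precisely, let $\mathbf{u}^{(n)}\in\mathbb{R}^{I_n}$ be the vector with all entries equal to $1/I_n$ for $n=1,\dots,N-1$, let $\mathbf{U}^{(N)}=\mathbf{U}^{(N+1)}=\mathbf{I}_{I_N}$ be the $I_N\times I_N$ identity matrix, let $\mathcal{G}\in\mathbb{R}^{1\times\cdots\times 1\times I_N\times I_N}$ (with $N-1$ leading modes of size $1$) be the identity matrix $\mathbf{I}_{I_N}$ viewed as a tensor, i.e. $\mathcal{G}_{1,\dots,1,a,b}=1$ if $a=b$ and $0$ otherwise, and let $\mathcal{W}=[\![\mathcal{G};\mathbf{u}^{(1)},\dots,\mathbf{u}^{(N-1)},\mathbf{U}^{(N)},\mathbf{U}^{(N+1)}]\!]\in\mathbb{R}^{I_1\times\cdots\times I_N\times I_N}$. Then for every $\mathcal{X}\in\mathbb{R}^{I_1\times\cdots\times I_N}$ and every $i_N\in\{1,\dots,I_N\}$, $$\left(\mathcal{W}_{(N+1)}\,\mathrm{vec}(\mathcal{X})\right)_{i_N}=\left(\prod_{n=1}^{N-1}I_n^{-1}\right)\sum_{i_1=1}^{I_1}\sum_{i_2=1}^{I_2}\cdots\sum_{i_{N-1}=1}^{I_{N-1}}\mathcal{X}_{i_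1,i_2,\dots,i_N}=(\mathbf{y})_{i_N}.$$
   Context: GAP layer: given $\mathcal{X}\in\mathbb{R}^{I_1\times\cdots\times I_N}$ (the last mode being the output-channel axis), it outputs $\mathbf{y}\in\mathbb{R}^{I_N}$ with $(\mathbf{y})_{i_N}=\left(\prod_{n=1}^{N-1}I_n^{-1}\right)\sum_{i_1=1}^{I_1}\cdots\sum_{i_{N-1}=1}^{I_{N-1}}\mathcal{X}_{i_1,\dots,i_N}$. Tucker format: for a core tensor $\mathcal{G}\in\mathbb{R}^{R_1\times\cdots\times R_{N+1}}$ and matrices $\mathbf{U}^{(k)}\in\mathbb{R}^{I_k\times R_k}$, $k=1,\dots,N+1$, the tensor $[\![\mathcal{G};\mathbf{U}^{(1)},\dots,\mathbf{U}^{(N+1)}]\!]\in\mathbb{R}^{I_1\times\cdots\times I_{N+1}}$ has entries $\sum_{r_1,\dots,r_{N+1}}\mathcal{G}_{r_1,\dots,r_{N+1}}\prod_{k=1}^{N+1}\mathbf{U}^{(k)}_{i_k,r_k}$; the tuple $(R_1,\dots,R_{N+1})$ is the rank of this Tucker decomposition. A vector $\mathbf{u}^{(n)}\in\mathbb{R}^{I_n}$ used as a factor is regarded as an $I_n\times 1$ matrix. Tensor regression layer (TRL): a map $f:\mathbb{R}^{I_1\times\cdots\times I_N}\to\mathbb{R}^{I_{N+1}}$, $f(\mathcal{X})=\mathcal{W}_{(N+1)}\mathrm{vec}(\mathcal{X})+\mathbf{b}$, with weight tensor $\mathcal{W}\in\mathbb{R}^{I_1\times\cdots\times I_N\times I_{N+1}}$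 and bias $\mathbf{b}\in\mathbb{R}^{I_{N+1}}$. It is a Tucker-TRL of rank $(R_1,\dots,R_{N+1})$ if $\mathcal{W}$ is given by a Tucker decomposition of that rank. Here $I_{N+1}=I_N$. The matrix $\mathcal{W}_{(N+1)}\in\mathbb{R}^{I_{N+1}\times I_1\cdots I_N}$ is the mode-$(N+1)$ unfolding, whose columns are the mode-$(N+1)$ fibers of $\mathcal{W}$ ordered consistently with the vectorization $\mathrm{vec}(\mathcal{X})$; thus entrywise $(\mathcal{W}_{(N+1)}\mathrm{vec}(\mathcal{X}))_{j}=\sum_{i_1,\dots,i_N}\mathcal{W}_{i_1,\dots,i_N,j}\,\mathcal{X}_{i_1,\dots,i_N}$. *)

theory Defs
  imports "Jordan_Normal_Form.Matrix" "HOL-Library.FuncSet"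
begin

text \<open>
  All indices are zero-based, as in \<^theory>\<open>Jordan_Normal_Form.Matrix\<close>: an index
  $i_k \in \{1,\dots,I_k\}$ appears here as a natural number below $I_k$, and the $k$-th mode
  of a tensor is the position $k-1$ of its multi-indices.
\<close>

definition multi_indices :: "nat list \<Rightarrow> nat list set" where
  "multi_indices ds = {is. length is = length ds \<and> (\<forall>k<length ds. is ! k < ds ! k)}"

type_synonym tensor = "nat list \<Rightarrow> real"

text \<open>The order of a tensor and its dimensions vary with \<open>ds\<close>, so the space
  $\mathbb{R}^{d_1\times\cdots\times d_m}$ is a set of extensional functions, not a type.\<close>

definition tensor_space :: "nat list \<Rightarrow> tensor set" where
  "tensor_space ds = multi_indices ds \<rightarrow>\<^sub>E UNIV"

text \<open>The column-major enumeration of the multi-indices (the first index varies fastest). It fixes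
  both the order of the entries of a vectorization and the order of the columns of an unfolding.\<close>

fun index_list :: "nat list \<Rightarrow> nat list list" where
  "index_list [] = [[]]"
| "index_list (d # ds) = concat (map (\<lambda>is. map (\<lambda>i. i # is) [0..<d]) (index_list ds))"

lemma length_index_list: "length (index_list ds) = prod_list ds"
  by (induction ds) (simp_all add: length_concat o_def sum_list_triv)

lemma set_index_list: "set (index_list ds) = multi_indices ds"
proof (induction ds)
  case Nil
  show ?case by (simp add: multi_indices_def)
next
  case (Cons d ds)
  have "is \<in> multi_indices (d # ds) \<longleftrightarrow> (\<exists>i js. is = i # js \<and> i < d \<and> js \<in> multi_indices ds)"
    for "is"
    by (cases "is") (auto simp: multi_indices_def nth_Cons less_Suc_eq_0_disj split: nat.splits)
  then have "multi_indices (d # ds) = (\<Union>js\<in>multi_indices ds. (\<lambda>i. i # js) ` {0..<d})"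
    by fastforce
  then show ?case
    by (simp add: Cons)
qed

lemma distinct_index_list: "distinct (index_list ds)"
proof (induction ds)
  case (Cons d ds)
  show ?case
  proof (cases "d = 0")
    case False
    have "map (\<lambda>i. i # is) [0..<d] \<noteq> map (\<lambda>i. i # js) [0..<d]" if "is \<noteq> js" for "is" js
    proof
      assume "map (\<lambda>i. i # is) [0..<d] = map (\<lambda>i. i # js) [0..<d]"
      then have "map (\<lambda>i. i # is) [0..<d] ! 0 = map (\<lambda>i. i # js) [0..<d] ! 0"
        by (rule arg_cong)
      then show False
        using False that by simp
    qed
    then have "inj (\<lambda>is. map (\<lambda>i. i # is) [0..<d])"
      unfolding inj_def by blast
    then have "distinct (map (\<lambda>is. map (\<lambda>i. i # is) [0..<d]) (index_list ds))"
      using Cons by (auto simp: distinct_map intro: inj_on_subset)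
    moreover have "distinct (map (\<lambda>i. i # is) [0..<d])" for "is"
      by (simp add: distinct_map inj_on_def)
    ultimately show ?thesis
      unfolding index_list.simps by (intro distinct_concat) auto
  next
    case True
    then have "index_list (d # ds) = []"
      by simp
    then show ?thesis
      by (simp only: distinct.simps)
  qed
qed simp

definition vectorize :: "nat list \<Rightarrow> tensor \<Rightarrow> real vec" where
  "vectorize ds X = vec (prod_list ds) (\<lambda>p. X (index_list ds ! p))"

text \<open>The unfolding along position \<open>k\<close>. Column \<open>p\<close> is the fiber obtained by fixing the indices at
  all other positions to the \<open>p\<close>-th multi-index of the remaining dimensions.\<close>

definition unfolding_mat :: "nat list \<Rightarrow> nat \<Rightarrow> tensor \<Rightarrow> real mat" where
  "unfolding_mat ds k W =
     (let ds' = take k ds @ drop (Suc k) ds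
      in mat (ds ! k) (prod_list ds')
           (\<lambda>(j, p). let is = index_list ds' ! p in W (take k is @ j # drop k is)))"

definition tucker :: "tensor \<Rightarrow> real mat list \<Rightarrow> tensor" where
  "tucker G Us =
     (\<lambda>is\<in>multi_indices (map dim_row Us).
        \<Sum>rs\<in>multi_indices (map dim_col Us). G rs * (\<Prod>k<length Us. Us ! k $$ (is ! k, rs ! k)))"

text \<open>\<open>G\<close> and \<open>Us\<close> form a Tucker decomposition of rank \<open>Rs\<close> of the tensor \<open>W\<close> of dimensions \<open>ds\<close>.\<close>

definition tucker_decomposition ::
    "nat list \<Rightarrow> nat list \<Rightarrow> tensor \<Rightarrow> real mat list \<Rightarrow> tensor \<Rightarrow> bool" where
  "tucker_decomposition ds Rs G Us W \<longleftrightarrow>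
     length Rs = length ds \<and> length Us = length ds \<and>
     (\<forall>k<length ds. Us ! k \<in> carrier_mat (ds ! k) (Rs ! k)) \<and>
     G \<in> tensor_space Rs \<and> W = tucker G Us"

definition trl :: "nat list \<Rightarrow> nat \<Rightarrow> tensor \<Rightarrow> real vec \<Rightarrow> tensor \<Rightarrow> real vec" where
  "trl ds m W b X = unfolding_mat (ds @ [m]) (length ds) W *\<^sub>v vectorize ds X + b"

text \<open>\<open>f\<close> is the Tucker tensor regression layer of rank \<open>Rs\<close> from tensors of dimensions \<open>ds\<close> to
  \<open>m\<close>-dimensional vectors with weight tensor \<open>W\<close> and bias \<open>b\<close>.\<close>

definition is_tucker_trl ::
    "nat list \<Rightarrow> nat \<Rightarrow> nat list \<Rightarrow> tensor \<Rightarrow> real vec \<Rightarrow> (tensor \<Rightarrow> real vec) \<Rightarrow> bool" where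
  "is_tucker_trl ds m Rs W b f \<longleftrightarrow>
     W \<in> tensor_space (ds @ [m]) \<and> b \<in> carrier_vec m \<and>
     (\<exists>G Us. tucker_decomposition (ds @ [m]) Rs G Us W) \<and>
     (\<forall>X\<in>tensor_space ds. f X = trl ds m W b X)"

definition gap :: "nat list \<Rightarrow> tensor \<Rightarrow> real vec" where
  "gap ds X = vec (last ds)
     (\<lambda>j. (\<Prod>d\<leftarrow>butlast ds. inverse (real d)) * (\<Sum>is\<in>multi_indices (butlast ds). X (is @ [j])))"

text \<open>The entrywise form of the linear part of a tensor regression layer.\<close>

lemma unfolding_mat_mult_vectorize:
  assumes "j < m"
  shows "(unfolding_mat (ds @ [m]) (length ds) W *\<^sub>v vectorize ds X) $ j =
    (\<Sum>is\<in>multi_indices ds. W (is @ [j]) * X is)"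
proof -
  let ?L = "index_list ds"
  have len: "length is = length ds" if "is \<in> set ?L" for "is"
    using that by (simp add: set_index_list multi_indices_def)
  have "(unfolding_mat (ds @ [m]) (length ds) W *\<^sub>v vectorize ds X) $ j =
      (\<Sum>p<length ?L. W (take (length ds) (?L ! p) @ j # drop (length ds) (?L ! p)) * X (?L ! p))"
    using assms
    by (auto simp: unfolding_mat_def vectorize_def scalar_prod_def Let_def length_index_list
        atLeast0LessThan intro!: sum.cong)
  also have "\<dots> = (\<Sum>p<length ?L. W (?L ! p @ [j]) * X (?L ! p))"
    using len by (intro sum.cong) simp_all
  also have "\<dots> = (\<Sum>is\<leftarrow>?L. W (is @ [j]) * X is)"
    by (simp add: sum_list_sum_nth atLeast0LessThan)
  also have "\<dots> = (\<Sum>is\<in>multi_indices ds. W (is @ [j]) * X is)"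
    by (simp add: sum_list_distinct_conv_sum_set distinct_index_list set_index_list)
  finally show ?thesis .
qed

end

theory Submission
  imports Defs
begin

text \<open>
  An identity factor in the last mode leaves the core unchanged in that mode, so peeling off both
  identity factors turns an entry of the weight tensor into the core entry at \<open>(0, \<dots>, 0, a, j)\<close>
  times the entries of the column factors. The core being the identity, only \<open>a = j\<close> contributes.
\<close>

lemma snoc_in_multi_indices_iff [simp]:
  "is @ [j] \<in> multi_indices (ds @ [m]) \<longleftrightarrow> is \<in> multi_indices ds \<and> j < m"
  by (auto simp: multi_indices_def nth_append less_Suc_eq)

text \<open>Appending the last index is a bijection from
  \<open>multi_indices ds \<times> {..<m}\<close>. This separates the last core mode inside
  \<open>tucker\<close> and the channel mode of \<open>X\<close> in the linear part.\<close>

lemma sum_multi_indices_snoc: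
  "(\<Sum>is\<in>multi_indices (ds @ [m]). f is) = (\<Sum>is\<in>multi_indices ds. \<Sum>j<m. f (is @ [j]))"
proof -
  have "multi_indices (ds @ [m]) = (\<lambda>(is, j). is @ [j]) ` (multi_indices ds \<times> {..<m})" (is "?A = ?B")
  proof
    show "?A \<subseteq> ?B"
    proof
      fix js assume js: "js \<in> ?A"
      then have "js \<noteq> []"
        by (auto simp: multi_indices_def)
      then have "js = butlast js @ [last js]"
        by simp
      then show "js \<in> ?B"
        using js by (metis (no_types, lifting) SigmaI case_prod_conv imageI lessThan_iff
            snoc_in_multi_indices_iff)
    qed
  qed auto
  moreover have "inj_on (\<lambda>(is, j). is @ [j]) (multi_indices ds \<times> {..<m})"
    by (auto simp: inj_on_def)
  ultimately show ?thesis
    by (simp add: sum.reindex sum.cartesian_product case_prod_unfold)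
qed

lemma multi_indices_replicate_1: "multi_indices (replicate n (Suc 0)) = {replicate n 0}"
  by (auto simp: multi_indices_def intro: nth_equalityI)

text \<open>The factor contributed by the new mode is the Kronecker delta of \<open>j\<close> and
  the last core index, so the sum over that index collapses. The sliced core is again an arbitrary
  function, which allows the lemma to be applied repeatedly.\<close>

lemma tucker_snoc_one_mat:
  assumes "is \<in> multi_indices (map dim_row Us)" and "j < m"
  shows "tucker G (Us @ [1\<^sub>m m]) (is @ [j]) = tucker (\<lambda>rs. G (rs @ [j])) Us is"
proof -
  have len: "length is = length Us"
    using assms(1) by (simp add: multi_indices_def)
  have entry: "(\<Prod>k<Suc (length Us). (Us @ [1\<^sub>m m]) ! k $$ ((is @ [j]) ! k, (rs @ [b]) ! k)) =
      (if j = b then \<Prod>k<length Us. Us ! k $$ (is ! k, rs ! k) else 0)"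
    if "rs \<in> multi_indices (map dim_col Us)" "b < m" for rs b
  proof -
    have "length rs = length Us"
      using that by (simp add: multi_indices_def)
    then show ?thesis
      using len that assms(2) by (simp add: nth_append)
  qed
  have "tucker G (Us @ [1\<^sub>m m]) (is @ [j]) =
      (\<Sum>rs\<in>multi_indices (map dim_col Us). \<Sum>b<m. G (rs @ [b]) *
        (\<Prod>k<Suc (length Us). (Us @ [1\<^sub>m m]) ! k $$ ((is @ [j]) ! k, (rs @ [b]) ! k)))"
    using assms by (simp add: tucker_def sum_multi_indices_snoc del: prod.lessThan_Suc)
  also have "\<dots> = (\<Sum>rs\<in>multi_indices (map dim_col Us). \<Sum>b<m.
        if j = b then G (rs @ [b]) * (\<Prod>k<length Us. Us ! k $$ (is ! k, rs ! k)) else 0)"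
    by (intro sum.cong) (simp_all add: entry del: prod.lessThan_Suc)
  also have "\<dots> = tucker (\<lambda>rs. G (rs @ [j])) Us is"
    using assms by (simp add: tucker_def)
  finally show ?thesis .
qed

text \<open>Every core mode has size one, so the Tucker sum has a single term, at the zero
  multi-index.\<close>

lemma tucker_column_factors:
  assumes "\<And>U. U \<in> set Us \<Longrightarrow> dim_col U = 1" and "is \<in> multi_indices (map dim_row Us)"
  shows "tucker G Us is = G (replicate (length Us) 0) * (\<Prod>k<length Us. Us ! k $$ (is ! k, 0))"
proof -
  have "map dim_col Us = replicate (length Us) (Suc 0)"
    using assms(1) by (intro nth_equalityI) auto
  then show ?thesis
    using assms(2) by (simp add: tucker_def multi_indices_replicate_1)
qed

lemma tucker_in_tensor_space: "tucker G Us \<in> tensor_space (map dim_row Us)"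
  by (simp add: tucker_def tensor_space_def)

theorem mainTheorem2:
  fixes N :: nat and I :: "nat \<Rightarrow> nat"
    and Is Rs :: "nat list"
    and u :: "nat \<Rightarrow> real vec" and Us :: "real mat list" and G W :: tensor
  assumes "N \<ge> 2"
    and "\<And>n. n \<in> {1..N} \<Longrightarrow> I n > 0"
    and "Is = map I [1..<N+1]"
    and "Rs = replicate (N - 1) 1 @ [I N, I N]"
    and "\<And>n. n \<in> {1..N-1} \<Longrightarrow> u n = vec (I n) (\<lambda>_. 1 / real (I n))"
    and "Us = map (\<lambda>n. mat_of_cols (I n) [u n]) [1..<N] @ [1\<^sub>m (I N), 1\<^sub>m (I N)]"
    and "G = (\<lambda>rs\<in>multi_indices Rs. if rs ! (N - 1) = rs ! N then 1 else 0)"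
    and "W = tucker G Us"
  shows "tucker_decomposition (Is @ [I N]) Rs G Us W \<and>
    is_tucker_trl Is (I N) Rs W (0\<^sub>v (I N)) (gap Is) \<and>
    (\<forall>X\<in>tensor_space Is. \<forall>i<I N.
       (unfolding_mat (Is @ [I N]) N W *\<^sub>v vectorize Is X) $ i =
         (\<Prod>n=1..N-1. inverse (real (I n))) *
         (\<Sum>is\<in>multi_indices (map I [1..<N]). X (is @ [i])) \<and>
       (\<Prod>n=1..N-1. inverse (real (I n))) *
         (\<Sum>is\<in>multi_indices (map I [1..<N]). X (is @ [i])) = gap Is X $ i)"
proof -
  let ?ds = "map I [1..<N]" and ?Vs = "map (\<lambda>n. mat_of_cols (I n) [u n]) [1..<N]"
  let ?c = "\<Prod>n=1..N-1. inverse (real (I n))"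
  have Is: "Is = ?ds @ [I N]"
    using assms(1,3) by simp
  have Us: "Us = (?Vs @ [1\<^sub>m (I N)]) @ [1\<^sub>m (I N)]"
    using assms(6) by simp
  have rows: "map dim_row ?Vs = ?ds"
    by simp
  have lenIs: "length Is = N"
    using assms(1) by (simp add: Is)
  \<comment> \<open>Mode \<open>n\<close> occupies the zero-based position \<open>n - 1\<close>, so
    position \<open>k\<close> carries the dimension \<open>I (Suc k)\<close>.\<close>
  have c_eq: "?c = (\<Prod>k<N - 1. inverse (real (I (Suc k))))"
    by (rule prod.reindex_bij_witness[of _ Suc "\<lambda>n. n - 1"]) auto
  have W_entry: "W ((is @ [a]) @ [j]) = (if a = j then ?c else 0)"
    if "is": "is \<in> multi_indices ?ds" and "a < I N" "j < I N" for "is" a j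
  proof -
    have Rs: "Rs = (replicate (N - 1) (Suc 0) @ [I N]) @ [I N]"
      using assms(4) by simp
    \<comment> \<open>\<open>G\<close> is extensional: only at indices within \<open>Rs\<close> does
      it take the value 0 or 1 given by its defining formula.\<close>
    have core: "(replicate (N - 1) 0 @ [a]) @ [j] \<in> multi_indices Rs"
      unfolding Rs snoc_in_multi_indices_iff using that by (simp add: multi_indices_replicate_1)
    \<comment> \<open>The outer identity factor fixes the last core index to \<open>j\<close>, then
      the inner one fixes the index before it to \<open>a\<close>. Only the column factors
      remain.\<close>
    have "W ((is @ [a]) @ [j]) = tucker (\<lambda>rs. G ((rs @ [a]) @ [j])) ?Vs is"
    proof -
      have "is @ [a] \<in> multi_indices (map dim_row (?Vs @ [1\<^sub>m (I N)]))"
        unfolding map_append rows using that by simp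
      then show ?thesis
        unfolding assms(8) Us using that
        by (simp only: tucker_snoc_one_mat rows)
    qed
    also have "\<dots> = G ((replicate (N - 1) 0 @ [a]) @ [j]) * (\<Prod>k<N - 1. ?Vs ! k $$ (is ! k, 0))"
      using "is" by (subst tucker_column_factors) (auto simp: o_def)
    also have "(\<Prod>k<N - 1. ?Vs ! k $$ (is ! k, 0)) = ?c"
      unfolding c_eq
    proof (rule prod.cong)
      fix k assume k: "k \<in> {..<N - 1}"
      then have "is ! k < I (Suc k)"
        using "is" by (auto simp: multi_indices_def)
      then show "?Vs ! k $$ (is ! k, 0) = inverse (real (I (Suc k)))"
        using k assms(5)[of "Suc k"] by (auto simp: mat_of_cols_index inverse_eq_divide)
    qed simp
    also have "G ((replicate (N - 1) 0 @ [a]) @ [j]) = (if a = j then 1 else 0)"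
      using core assms(1) by (auto simp: assms(7) nth_append)
    finally show ?thesis
      by simp
  qed
  \<comment> \<open>\<open>X\<close> may be any function here, since both sides evaluate it only at
    multi-indices of \<open>Is\<close>. The inner sum over the input channel \<open>a\<close> keeps
    only \<open>a = j\<close>, where the weight is the constant \<open>?c\<close>.\<close>
  have linear_part: "(unfolding_mat (Is @ [I N]) N W *\<^sub>v vectorize Is X) $ j =
      ?c * (\<Sum>is\<in>multi_indices ?ds. X (is @ [j]))" if "j < I N" for X j
  proof -
    have "(unfolding_mat (Is @ [I N]) N W *\<^sub>v vectorize Is X) $ j =
        (\<Sum>is\<in>multi_indices Is. W (is @ [j]) * X is)"
      using unfolding_mat_mult_vectorize[OF that, of Is W X] by (simp only: lenIs)
    also have "\<dots> = (\<Sum>is\<in>multi_indices ?ds. \<Sum>a<I N. W ((is @ [a]) @ [j]) * X (is @ [a]))"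
      unfolding Is by (rule sum_multi_indices_snoc)
    also have "\<dots> = (\<Sum>is\<in>multi_indices ?ds. \<Sum>a<I N. if a = j then ?c * X (is @ [a]) else 0)"
      using that by (intro sum.cong refl) (simp only: W_entry lessThan_iff, simp)
    also have "\<dots> = ?c * (\<Sum>is\<in>multi_indices ?ds. X (is @ [j]))"
      using that by (simp add: sum_distrib_left)
    finally show ?thesis .
  qed
  have gap_entry: "?c * (\<Sum>is\<in>multi_indices ?ds. X (is @ [j])) = gap Is X $ j"
    if "j < I N" for X j
  proof -
    \<comment> \<open>\<open>gap\<close> multiplies along the list \<open>butlast Is\<close>, which
      is \<open>?ds\<close>; as \<open>[1..<N]\<close> has no repetitions, this agrees with the
      product over the set of modes.\<close>
    have "(\<Prod>d\<leftarrow>?ds. inverse (real d)) = ?c"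
    proof -
      have "{1..<N} = {1..N-1}"
        by auto
      then show ?thesis
        using prod.distinct_set_conv_list[of "[1..<N]" "\<lambda>n. inverse (real (I n))"]
        by (simp add: o_def)
    qed
    then show ?thesis
      using that by (simp add: gap_def Is o_def)
  qed
  have decomposition: "tucker_decomposition (Is @ [I N]) Rs G Us W"
    unfolding tucker_decomposition_def
  proof (intro conjI allI impI)
    fix k assume "k < length (Is @ [I N])"
    \<comment> \<open>The three kinds of factor: a single column, the identity of the input channel
      mode, and the identity of the output mode.\<close>
    then consider "k < N - 1" | "k = N - 1" | "k = N"
      using lenIs by force
    then show "Us ! k \<in> carrier_mat ((Is @ [I N]) ! k) (Rs ! k)"
      using assms(1) by cases (auto simp: assms(4) Us Is nth_append)
  qed (use assms(1) in \<open>auto simp: assms(4,6,7,8) Is tensor_space_def\<close>)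
  have "map dim_row Us = Is @ [I N]"
    by (simp add: Us Is)
  then have W_space: "W \<in> tensor_space (Is @ [I N])"
    using tucker_in_tensor_space[of G Us] by (simp add: assms(8))
  \<comment> \<open>The zero bias reduces each entry of the layer to its linear part, which
    \<open>linear_part\<close> and \<open>gap_entry\<close> both express through the same
    average.\<close>
  have "gap Is X = trl Is (I N) W (0\<^sub>v (I N)) X" for X
  proof
    show "dim_vec (gap Is X) = dim_vec (trl Is (I N) W (0\<^sub>v (I N)) X)"
      by (simp add: gap_def trl_def Is)
  next
    fix j assume "j < dim_vec (trl Is (I N) W (0\<^sub>v (I N)) X)"
    then have j: "j < I N"
      by (simp add: trl_def)
    then have "trl Is (I N) W (0\<^sub>v (I N)) X $ j =
        (unfolding_mat (Is @ [I N]) N W *\<^sub>v vectorize Is X) $ j"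
      unfolding trl_def lenIs
      by (simp only: index_add_vec index_zero_vec add_0_right)
    then show "gap Is X $ j = trl Is (I N) W (0\<^sub>v (I N)) X $ j"
      using linear_part[OF j] gap_entry[OF j] by simp
  qed
  then have "is_tucker_trl Is (I N) Rs W (0\<^sub>v (I N)) (gap Is)"
    unfolding is_tucker_trl_def using W_space decomposition by auto
  then show ?thesis
    using decomposition linear_part gap_entry by blast
qed

end
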